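(* For every integer $k\ge1$ there is a constant $C>0$ such that $r_n:=Cn^k$, $n\ge1$, is the free cumulant sequence of some probability distribution on $\mathbb{R}$ (with compact support).
   Context: For a compactly supported probability distribution $\mu$ on $\mathbb{R}$ let $M_\mu(z)=\int_{\mathbb{R}}\frac{\mu(dx)}{1-xz}$ for $z$ near $0$. The free $R$-transform $R_\mu$ is the analytic function near $0$ determined by $1+R_\mu(zM_\mu(z))=M_\mu(z)$ for $z$ near $0$. The free cumulants $r_n(\mu)$, $n\ge1$, of $\mu$ are the Taylor coefficients in $R_\mu(w)=\sum_{n=1}^\infty r_n(\mu)w^n$. *)

theory Defs
  imports "HOL-Probability.Probability"
begin

definition compactly_supported_distribution :: "real measure \<Rightarrow> bool" where
  "compactly_supported_distribution \<mu> \<longleftrightarrow>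
     real_distribution \<mu> \<and> (\<exists>K. compact K \<and> (AE x in \<mu>. x \<in> K))"

definition moment_transform :: "real measure \<Rightarrow> complex \<Rightarrow> complex" where
  "moment_transform \<mu> z = (LINT x|\<mu>. 1 / (1 - complex_of_real x * z))"

text \<open>The equation for the free R-transform determines it only as a germ at 0, so it is
  rendered as a relation between a distribution and its local representatives.\<close>

definition is_free_R_transform :: "real measure \<Rightarrow> (complex \<Rightarrow> complex) \<Rightarrow> bool" where
  "is_free_R_transform \<mu> R \<longleftrightarrow>
     R analytic_on {0} \<and>
     (\<forall>\<^sub>F z in nhds 0. 1 + R (z * moment_transform \<mu> z) = moment_transform \<mu> z)"

text \<open>Free cumulants are indexed from 1; the value \<open>r 0\<close> is irrelevant.\<close>

definition has_free_cumulants :: "real measure \<Rightarrow> (nat \<Rightarrow> real) \<Rightarrow> bool" where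
  "has_free_cumulants \<mu> r \<longleftrightarrow>
     (\<exists>R. is_free_R_transform \<mu> R \<and>
        (\<forall>\<^sub>F w in nhds 0. (\<lambda>n. complex_of_real (r (Suc n)) * w ^ Suc n) sums R w))"

end

theory Submission
  imports Defs "HOL-Complex_Analysis.Complex_Analysis"
begin

text \<open>
  Write \<open>R(w) = w H(w)\<close> and \<open>K(w) = 1/w + H(w)\<close>; the Cauchy transform of the desired distribution is
  the inverse of \<open>K\<close> at \<open>0\<close>. For \<open>C = 1/r\<^sup>2\<close> with small \<open>r\<close>, the function \<open>K\<close> is, after an affine change
  of variables, close to \<open>1/v + 2\<^sup>k v\<close> on the disc of radius \<open>r\<close>, and comparing imaginary parts of
  divided differences shows that it is univalent on the lower half of that disc, with negative
  imaginary part on the bounding arc. Hence its image of the half disc contains the upper half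
  plane, where it has a bounded holomorphic inverse \<open>g\<close>. The boundary values of \<open>Im g\<close> on the real
  line exist everywhere by compactness, so \<open>- Im g / pi\<close> yields a density by bounded convergence.
  It vanishes outside a compact interval since \<open>g\<close> continues to a real symmetric function around
  infinity, and integrating over half discs identifies its moments.
\<close>

section \<open>Inverting a function that is univalent on a half disc\<close>

lemma convergent_subseq_cball:
  fixes w :: "nat \<Rightarrow> complex"
  assumes "\<And>n. cmod (w n) \<le> r"
  obtains l \<phi> where "strict_mono (\<phi> :: nat \<Rightarrow> nat)" "(w \<circ> \<phi>) \<longlonglongrightarrow> l"
proof -
  have "compact (cball (0::complex) r)" by simp
  then have "seq_compact (cball (0::complex) r)"
    by (simp add: compact_imp_seq_compact)
  then show thesis
    using that assms unfolding seq_compact_def by (metis mem_cball_0)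
qed

text \<open>The geometric input is \<open>inj\<close> and \<open>arc\<close>. Because
  \<open>r < s\<close>, \<open>H\<close> is continuous up to the boundary of the half disc, and
  \<open>H_cnj\<close> makes \<open>inverse w + H w\<close> real at the nonzero points of its
  diameter.\<close>

locale half_disc_univalent =
  fixes H :: "complex \<Rightarrow> complex" and r s :: real
  assumes r_pos: "0 < r" and r_less: "r < s"
    and holo_H: "H holomorphic_on ball 0 s"
    and H_cnj: "\<And>w. cmod w < s \<Longrightarrow> H (cnj w) = cnj (H w)"
    and inj: "inj_on (\<lambda>w. inverse w + H w) {w. cmod w < r \<and> Im w < 0}"
    and arc: "\<And>w. cmod w = r \<Longrightarrow> Im w < 0 \<Longrightarrow> Im (inverse w + H w) < 0"
begin

definition K :: "complex \<Rightarrow> complex" where "K w = inverse w + H w"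

definition lower :: "complex set" where "lower = {w. cmod w < r \<and> Im w < 0}"

definition g :: "complex \<Rightarrow> complex" where "g = inv_into lower K"

lemma inj_K: "inj_on K lower"
proof -
  have "K = (\<lambda>w. inverse w + H w)" by (simp add: fun_eq_iff K_def)
  then show ?thesis using inj by (simp add: lower_def)
qed

lemma open_lower: "open lower"
proof -
  have "lower = ball 0 r \<inter> {w. Im w < 0}" by (auto simp: lower_def)
  then show ?thesis by (simp add: open_halfspace_Im_lt open_Int)
qed

lemma lower_nonzero: "w \<in> lower \<Longrightarrow> w \<noteq> 0"
  by (auto simp: lower_def)

lemma holo_K: "K holomorphic_on ball 0 s - {0}"
  unfolding K_def by (intro holomorphic_intros holomorphic_on_subset[OF holo_H]) auto

lemma lower_subset: "lower \<subseteq> ball 0 s - {0}"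
  using r_less by (auto simp: lower_def)

lemma holo_K_lower: "K holomorphic_on lower"
  by (rule holomorphic_on_subset[OF holo_K lower_subset])

lemma open_K_lower: "open (K ` lower)"
  by (rule open_mapping_thm3[OF holo_K_lower open_lower inj_K])

lemma g_K [simp]: "w \<in> lower \<Longrightarrow> g (K w) = w"
  by (simp add: g_def inj_K)

lemma K_g [simp]: "z \<in> K ` lower \<Longrightarrow> K (g z) = z"
  by (simp add: g_def f_inv_into_f)

lemma g_lower: "z \<in> K ` lower \<Longrightarrow> g z \<in> lower"
  by auto

lemma holo_g: "g holomorphic_on K ` lower"
proof -
  obtain h where h: "h holomorphic_on K ` lower" "\<And>w. w \<in> lower \<Longrightarrow> h (K w) = w"
    using holomorphic_has_inverse[OF holo_K_lower open_lower inj_K] by metis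
  show ?thesis
    by (rule holomorphic_transform[OF h(1)]) (auto simp: h(2))
qed

lemma K_real:
  assumes "cmod w < s" "Im w = 0"
  shows "Im (K w) = 0"
proof -
  have "cnj w = w" using assms(2) by (simp add: complex_eq_iff)
  then have "cnj (K w) = K w" using H_cnj[OF assms(1)] by (simp add: K_def)
  then show ?thesis by (simp add: complex_eq_iff)
qed

text \<open>A form of properness: sequences in \<open>lower\<close> whose values approach the closed
  upper half plane can only escape over the real line. The limit \<open>l\<close> lies in the closed
  half disc; convergence of the values excludes the pole, the diameter yields only real values, and
  the open arc is excluded by \<open>arc\<close>.\<close>

lemma limit_cases:
  assumes w: "\<And>n. w n \<in> lower" "w \<longlonglongrightarrow> l" and z: "(\<lambda>n. K (w n)) \<longlonglongrightarrow> z" "Im z \<ge> 0"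
  shows "Im z = 0 \<and> Im l = 0 \<or> l \<in> lower \<and> K l = z"
proof -
  have "cmod l \<le> r"
    by (rule LIMSEQ_le_const2[OF tendsto_norm[OF w(2)]])
       (use w(1) in \<open>auto simp: lower_def intro!: exI[of _ 0] less_imp_le\<close>)
  then have ls: "cmod l < s" using r_less by simp
  have "Im l \<le> 0"
    by (rule LIMSEQ_le_const2[OF tendsto_Im[OF w(2)]])
       (use w(1) in \<open>auto simp: lower_def intro!: exI[of _ 0] less_imp_le\<close>)
  have isc: "isCont H l"
    using holo_H ls by (metis centre_in_ball continuous_on_eq_continuous_at dist_0_norm
        holomorphic_on_imp_continuous_on mem_ball open_ball)
  \<comment> \<open>At the pole, the identity \<open>w n * (K (w n) - H (w n)) = 1\<close> would
    pass to the limit as \<open>0 = 1\<close>.\<close>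
  have l0: "l \<noteq> 0"
  proof
    assume "l = 0"
    have "(\<lambda>n. H (w n)) \<longlonglongrightarrow> H l"
      by (rule isCont_tendsto_compose[OF isc w(2)])
    then have "(\<lambda>n. w n * (K (w n) - H (w n))) \<longlonglongrightarrow> l * (z - H l)"
      by (intro tendsto_intros w z)
    moreover have "w n * (K (w n) - H (w n)) = 1" for n
      using lower_nonzero[OF w(1)[of n]] by (simp add: K_def)
    ultimately have "(\<lambda>n::nat. 1::complex) \<longlonglongrightarrow> 0" using \<open>l = 0\<close> by simp
    then show False using LIMSEQ_unique tendsto_const by (metis zero_neq_one)
  qed
  have "isCont K l" unfolding K_def using isc l0 by (intro continuous_intros) auto
  then have "(\<lambda>n. K (w n)) \<longlonglongrightarrow> K l"
    by (rule isCont_tendsto_compose[OF _ w(2)])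
  then have Kl: "K l = z" using z(1) LIMSEQ_unique by blast
  show ?thesis
  proof (cases "Im l = 0")
    case True
    then show ?thesis using K_real[OF ls] Kl by auto
  next
    case False
    with \<open>Im l \<le> 0\<close> have "Im l < 0" by simp
    moreover have "cmod l \<noteq> r"
      using arc[of l] \<open>Im l < 0\<close> Kl z(2) by (auto simp: K_def)
    ultimately show ?thesis using \<open>cmod l \<le> r\<close> Kl by (auto simp: lower_def)
  qed
qed

lemma bounded_H: obtains B where "B > 0" "\<And>w. cmod w \<le> r \<Longrightarrow> cmod (H w) \<le> B"
proof -
  have "continuous_on (cball 0 r) H"
    by (rule continuous_on_subset[OF holomorphic_on_imp_continuous_on[OF holo_H]])
       (use r_less in auto)
  then have "bounded (H ` cball 0 r)"
    by (intro compact_imp_bounded compact_continuous_image) auto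
  then obtain B where "B > 0" "\<forall>x\<in>H ` cball 0 r. norm x \<le> B" by (auto simp: bounded_pos)
  then show thesis by (intro that[of B]) auto
qed

text \<open>The trace of the image on the upper half plane is open, and closed by \<open>limit_cases\<close>.\<close>
lemma upper_subset_image: "{z. Im z > 0} \<subseteq> K ` lower"
proof -
  let ?U = "{z. Im z > 0}"
  have op: "openin (top_of_set ?U) (K ` lower \<inter> ?U)"
    using open_K_lower by (metis inf_commute openin_open_Int)
  have cl: "closedin (top_of_set ?U) (K ` lower \<inter> ?U)"
    unfolding closedin_limpt
  proof (intro conjI allI impI)
    fix z assume "z islimpt K ` lower \<inter> ?U \<and> z \<in> ?U"
    then obtain x where x: "\<And>n. x n \<in> K ` lower \<inter> ?U" and xz: "x \<longlonglongrightarrow> z" and z: "Im z > 0"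
      unfolding islimpt_sequential by blast
    have gl: "g (x n) \<in> lower" "K (g (x n)) = x n" for n using x g_lower by auto
    have "cmod (g (x n)) \<le> r" for n using gl(1)[of n] by (simp add: lower_def)
    then obtain l \<phi> where \<phi>: "strict_mono \<phi>" "((\<lambda>n. g (x n)) \<circ> \<phi>) \<longlonglongrightarrow> l"
      by (rule convergent_subseq_cball)
    have "l \<in> lower \<and> K l = z"
      using limit_cases[of "(\<lambda>n. g (x n)) \<circ> \<phi>" l z] gl \<phi> z LIMSEQ_subseq_LIMSEQ[OF xz \<phi>(1)]
      by (auto simp: o_def)
    then show "z \<in> K ` lower \<inter> ?U" using z by auto
  qed auto
  obtain B where B: "B > 0" "\<And>w. cmod w \<le> r \<Longrightarrow> cmod (H w) \<le> B" using bounded_H by blast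
  \<comment> \<open>For nonemptiness the point \<open>- \<i> * t\<close> is tested: the pole
    contributes imaginary part \<open>1 / t \<ge> 2 * B\<close>, which outweighs the bound
    \<open>B\<close> on \<open>H\<close>.\<close>
  define t where "t = min (r/2) (1 / (2*B))"
  have t: "t > 0" "t < r" "t \<le> 1/(2*B)" using r_pos B by (auto simp: t_def)
  let ?w = "Complex 0 (-t)"
  have nw: "cmod ?w = t" using t by (simp add: cmod_def)
  have inl: "?w \<in> lower" using t nw by (simp add: lower_def)
  have "cmod (H ?w) \<le> B" using B nw t by simp
  then have "Im (H ?w) \<ge> - B" using abs_Im_le_cmod[of "H ?w"] by linarith
  moreover have "Im (inverse ?w) = 1 / t" 

    using t by (simp add: inverse_complex.code power2_eq_square divide_simps)
  moreover have "2 * B \<le> 1 / t" using t B by (simp add: field_simps)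
  ultimately have "Im (K ?w) > 0" using B by (simp add: K_def)
  then have ne: "K ` lower \<inter> ?U \<noteq> {}" using inl by blast
  have "connected ?U" by (simp add: convex_connected convex_halfspace_Im_gt)
  then have "K ` lower \<inter> ?U = ?U"
    using connected_clopen[of ?U] op cl ne by blast
  then show ?thesis by blast
qed

section \<open>The density as a boundary value of the inverse\<close>

definition dens :: "real \<Rightarrow> real" where
  "dens x = (if complex_of_real x \<in> K ` lower then - Im (g x) / pi else 0)"

lemma g_bounds: "z \<in> K ` lower \<Longrightarrow> cmod (g z) < r \<and> Im (g z) < 0"
  using g_lower by (auto simp: lower_def)

lemma dens_bounds: "0 \<le> dens x" "dens x \<le> r / pi"
proof -
  show "0 \<le> dens x" using g_bounds[of x] by (auto simp: dens_def divide_le_0_iff)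
  show "dens x \<le> r / pi"
    using g_bounds[of x] r_pos abs_Im_le_cmod[of "g x"] by (auto simp: dens_def divide_simps)
qed

text \<open>Stieltjes inversion, valid at every real point. Where \<open>x\<close> lies in the
  image, \<open>g\<close> is continuous. Elsewhere, if the imaginary parts did not tend to 0, a
  subsequence of the preimages would converge to a nonreal \<open>l\<close>, and
  \<open>limit_cases\<close> would put \<open>x = K l\<close> into the image. So the value 0 in
  \<open>dens\<close> is a genuine limit.\<close>

lemma dens_limit:
  assumes y: "\<And>n. y n > 0" "y \<longlonglongrightarrow> 0"
  shows "(\<lambda>n. - Im (g (Complex x (y n))) / pi) \<longlonglongrightarrow> dens x"
proof -
  have lim: "(\<lambda>n. Complex x (y n)) \<longlonglongrightarrow> complex_of_real x"
    using y(2) by (simp add: complex_of_real_def tendsto_Complex)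
  have up: "Complex x (y n) \<in> K ` lower" for n using upper_subset_image y(1) by auto
  show ?thesis
  proof (cases "complex_of_real x \<in> K ` lower")
    case True
    have "isCont g x"
      using holo_g open_K_lower True
      by (metis continuous_on_eq_continuous_at holomorphic_on_imp_continuous_on)
    then have "(\<lambda>n. g (Complex x (y n))) \<longlonglongrightarrow> g x" by (rule isCont_tendsto_compose[OF _ lim])
    then show ?thesis unfolding dens_def using True by (auto intro!: tendsto_intros)
  next
    case False
    have "(\<lambda>n. Im (g (Complex x (y n)))) \<longlonglongrightarrow> 0"
    proof (rule tendstoI, rule ccontr)
      fix e :: real
      assume e: "e > 0" and "\<not> (\<forall>\<^sub>F n in sequentially. dist (Im (g (Complex x (y n)))) 0 < e)"
      then obtain \<phi> :: "nat \<Rightarrow> nat" where \<phi>: "strict_mono \<phi>"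
        and far: "\<And>n. \<bar>Im (g (Complex x (y (\<phi> n))))\<bar> \<ge> e"
        using not_eventually_sequentiallyD [where P = "\<lambda>n. dist (Im (g (Complex x (y n)))) 0 < e"]
        by (auto simp: not_less)
      define w where "w n = g (Complex x (y (\<phi> n)))" for n
      have w: "w n \<in> lower" "K (w n) = Complex x (y (\<phi> n))" for n
        using up g_lower by (auto simp: w_def)
      have "cmod (w n) \<le> r" for n using w(1)[of n] by (simp add: lower_def)
      then obtain l \<psi> where \<psi>: "strict_mono \<psi>" "(w \<circ> \<psi>) \<longlonglongrightarrow> l"
        by (rule convergent_subseq_cball)
      have "(\<lambda>n. K ((w \<circ> \<psi>) n)) \<longlonglongrightarrow> complex_of_real x"
        using LIMSEQ_subseq_LIMSEQ[OF LIMSEQ_subseq_LIMSEQ[OF lim \<phi>] \<psi>(1)]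
        by (simp add: w o_def)
      then have "Im l = 0 \<or> l \<in> lower \<and> K l = x"
        using limit_cases[of "w \<circ> \<psi>" l "complex_of_real x"] w \<psi> by auto
      moreover have "K l \<in> K ` lower" if "l \<in> lower" using that by simp
      ultimately have "Im l = 0" using False by metis
      have "(\<lambda>n. \<bar>Im ((w \<circ> \<psi>) n)\<bar>) \<longlonglongrightarrow> \<bar>Im l\<bar>"
        by (intro tendsto_intros \<psi>)
      then have "\<bar>Im l\<bar> \<ge> e"
        by (rule LIMSEQ_le_const) (use far in \<open>auto simp: w_def\<close>)
      with \<open>Im l = 0\<close> e show False by simp
    qed
    then have "(\<lambda>n. - Im (g (Complex x (y n))) / pi) \<longlonglongrightarrow> - 0 / pi"
      by (rule tendsto_divide[OF tendsto_minus tendsto_const]) simp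
    then show ?thesis using False by (simp add: dens_def)
  qed
qed

section \<open>Continuation around infinity and moments\<close>

text \<open>Near \<open>0\<close>, inverting \<open>K w = 1 / v\<close> amounts to inverting \<open>w / (1 + w * H w) = v\<close>, which is regular.\<close>
lemma inverse_near_infinity:
  obtains A d h where "A > 0" "1 / A < d" "h holomorphic_on ball 0 d"
    "\<And>v. cmod v < d \<Longrightarrow> cmod (h v) < r"
    "\<And>v. cmod v < d \<Longrightarrow> h v = v * (1 + h v * H (h v))"
    "\<And>v. cmod v < d \<Longrightarrow> h (cnj v) = cnj (h v)"
    "\<And>z. z \<in> K ` lower \<Longrightarrow> cmod z \<ge> A \<Longrightarrow> g z = h (inverse z)"
    "\<And>x::real. \<bar>x\<bar> \<ge> A \<Longrightarrow> complex_of_real x \<notin> K ` lower"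
proof -
  define N where "N w = 1 + w * H w" for w
  define psi where "psi w = w / N w" for w
  have holo_N: "N holomorphic_on ball 0 s"
    unfolding N_def by (intro holomorphic_intros holo_H)
  define W where "W = ball 0 r \<inter> N -` (- {0})"
  have W_sub: "W \<subseteq> ball 0 s" using r_less by (auto simp: W_def)
  have "open W"
    unfolding W_def using r_less
    by (intro continuous_open_preimage holomorphic_on_imp_continuous_on
        holomorphic_on_subset[OF holo_N]) auto
  have W0: "0 \<in> W" using r_pos by (simp add: W_def N_def)
  have holo_psi: "psi holomorphic_on W"
    unfolding psi_def by (intro holomorphic_intros holomorphic_on_subset[OF holo_N W_sub])
      (auto simp: W_def)
  have "(psi has_field_derivative 1) (at 0)"
  proof -
    have "(N has_field_derivative deriv N 0) (at 0)"
      using r_pos r_less by (intro holomorphic_derivI[OF holo_N]) auto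
    then have "(psi has_field_derivative (1 * N 0 - 0 * deriv N 0) / (N 0 * N 0)) (at 0)"
      unfolding psi_def by (intro DERIV_divide DERIV_ident) (auto simp: N_def[where w = 0])
    then show ?thesis by (simp add: N_def)
  qed
  then have "deriv psi 0 \<noteq> 0" by (simp add: DERIV_imp_deriv)
  then obtain t where t: "t > 0" "ball 0 t \<subseteq> W" "inj_on psi (ball 0 t)"
    using has_complex_derivative_locally_injective[OF holo_psi W0 \<open>open W\<close>] by blast
  have tr: "t \<le> r" 
    using t(1,2) r_pos by (auto simp: W_def ball_subset_ball_iff)
  have holo_t: "psi holomorphic_on ball 0 t" by (rule holomorphic_on_subset[OF holo_psi t(2)])
  have "open (psi ` ball 0 t)" by (rule open_mapping_thm3[OF holo_t _ t(3)]) simp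
  moreover have "0 \<in> psi ` ball 0 t"
    using t(1) by (intro image_eqI[of _ _ 0]) (auto simp: psi_def)
  ultimately obtain d where d: "d > 0" "ball 0 d \<subseteq> psi ` ball 0 t"
    by (meson open_contains_ball)
  obtain h where h: "h holomorphic_on psi ` ball 0 t" "\<And>w. w \<in> ball 0 t \<Longrightarrow> h (psi w) = w"
    using holomorphic_has_inverse[OF holo_t open_ball t(3)] by metis
  have hv: "cmod (h v) < t" "psi (h v) = v" "N (h v) \<noteq> 0" if "cmod v < d" for v
  proof -
    have "v \<in> psi ` ball 0 t" using d(2) that by auto
    then obtain w where "cmod w < t" "v = psi w" by auto
    then show "cmod (h v) < t" "psi (h v) = v" "N (h v) \<noteq> 0" using h(2)[of w] t(2) by (auto simp: W_def)
  qed
  \<comment> \<open>\<open>psi\<close> commutes with conjugation and is injective on the disc of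
    radius \<open>t\<close>, so its inverse commutes with conjugation too.\<close>
  have h_cnj: "h (cnj v) = cnj (h v)" if "cmod v < d" for v
  proof -
    have "cmod (h v) < s" using hv(1)[OF that] tr r_less by simp
    then have "psi (cnj (h v)) = cnj v"
      using H_cnj[of "h v"] arg_cong[OF hv(2)[OF that], of cnj] by (simp add: psi_def N_def)
    then show ?thesis using h(2)[of "cnj (h v)"] hv(1)[OF that] by simp
  qed
  obtain B where B: "B > 0" "\<And>w. cmod w \<le> r \<Longrightarrow> cmod (H w) \<le> B" using bounded_H by blast
  \<comment> \<open>Since \<open>cmod (K w)\<close> is at most \<open>1 / cmod w + B\<close>, the
    bound \<open>A > B + 1/t\<close> forces \<open>cmod w < t\<close> once
    \<open>cmod (K w) \<ge> A\<close>; \<open>A > 1/d\<close> puts the reciprocals of such values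
    into the domain of \<open>h\<close>.\<close>
  define A where "A = B + 2/t + 2/d"
  have A: "A > B + 1/t" "A > 1/d" "A > 0"
    using B t(1) d(1) by (auto simp: A_def add_pos_pos intro!: add_strict_mono divide_strict_right_mono)
      (auto simp: field_simps add_pos_pos)
  have far: "h (inverse (K w)) = w" if w: "w \<in> lower" and "cmod (K w) \<ge> A" for w
  proof -
    have w0: "w \<noteq> 0" and wr: "cmod w \<le> r" using lower_nonzero[OF w] w by (auto simp: lower_def)
    have "A \<le> cmod (inverse w) + cmod (H w)"
      using that(2) norm_triangle_ineq[of "inverse w" "H w"] by (simp add: K_def)
    then have "1 / t < 1 / cmod w" using B(2)[OF wr] A by (simp add: norm_divide inverse_eq_divide)
    then have "cmod w < t" using t(1) w0 by (simp add: divide_simps)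
    moreover have "psi w = inverse (K w)" using w0 by (simp add: psi_def N_def K_def field_simps)
    ultimately show ?thesis using h(2)[of w] by simp
  qed
  show thesis
  proof (rule that[of A d h])
    show "A > 0" by fact
    show Ad: "1 / A < d" using A(2,3) d(1) by (simp add: field_simps)
    show "h holomorphic_on ball 0 d" by (rule holomorphic_on_subset[OF h(1) d(2)])
    show "cmod (h v) < r" if "cmod v < d" for v using hv(1)[OF that] tr by simp
    show "h v = v * (1 + h v * H (h v))" if "cmod v < d" for v
      using hv(2,3)[OF that] by (simp add: psi_def N_def field_simps)
    show "h (cnj v) = cnj (h v)" if "cmod v < d" for v by (rule h_cnj[OF that])
    show "g z = h (inverse z)" if z: "z \<in> K ` lower" "cmod z \<ge> A" for z
      using z far by auto
    \<comment> \<open>A preimage of such a real point would be the value of \<open>h\<close> at a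
      real argument, hence real by symmetry, whereas \<open>lower\<close> contains no real
      points.\<close>
    show "complex_of_real x \<notin> K ` lower" if x: "\<bar>x\<bar> \<ge> A" for x :: real
    proof
      assume "complex_of_real x \<in> K ` lower"
      then obtain w where w: "w \<in> lower" "K w = complex_of_real x" by force
      have hw: "h (inverse (complex_of_real x)) = w" using far[OF w(1)] x w(2) by simp
      have "cmod (inverse (complex_of_real x)) \<le> 1 / A"
        using x A(3) by (simp add: norm_inverse norm_divide divide_simps)
      then have "cnj w = w"
        using h_cnj[of "inverse (complex_of_real x)"] Ad hw by simp
      then have "Im w = 0" by (simp add: complex_eq_iff)
      then show False using w(1) by (simp add: lower_def)
    qed
  qed
qed

section \<open>Contour integrals over upper half discs\<close>

lemma continuous_g_line:
  assumes "y > 0"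
  shows "continuous_on X (\<lambda>x. g (Complex x y))"
proof (rule continuous_on_compose2[OF holomorphic_on_imp_continuous_on[OF holo_g]])
  show "(\<lambda>x. Complex x y) ` X \<subseteq> K ` lower" using upper_subset_image assms by auto
  show "continuous_on X (\<lambda>x. Complex x y)"
    by (simp only: Complex_eq) (intro continuous_intros)
qed

text \<open>The assumptions are exactly what \<open>inverse_near_infinity\<close> provides. In the
  coordinate \<open>v = 1 / z\<close>, \<open>h\<close> is the germ at infinity of the Cauchy
  transform, defined on both sides of the real axis, whereas \<open>g\<close> is available only on
  the image of \<open>lower\<close>.\<close>

context
  fixes A d :: real and h :: "complex \<Rightarrow> complex"
  assumes A: "A > 0" "1 / A < d"
    and holo_h: "h holomorphic_on ball 0 d"
    and h_less: "\<And>v. cmod v < d \<Longrightarrow> cmod (h v) < r"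
    and h_eq: "\<And>v. cmod v < d \<Longrightarrow> h v = v * (1 + h v * H (h v))"
    and h_cnj: "\<And>v. cmod v < d \<Longrightarrow> h (cnj v) = cnj (h v)"
    and g_far: "\<And>z. z \<in> K ` lower \<Longrightarrow> cmod z \<ge> A \<Longrightarrow> g z = h (inverse z)"
    and real_far: "\<And>x::real. \<bar>x\<bar> \<ge> A \<Longrightarrow> complex_of_real x \<notin> K ` lower"
begin

lemma one_minus_nonzero:
  assumes "A * cmod z < 1" "cmod \<zeta> \<le> A"
  shows "1 - \<zeta> * z \<noteq> 0" "1 - A * cmod z \<le> cmod (1 - \<zeta> * z)"
proof -
  have "cmod (\<zeta> * z) \<le> A * cmod z" using assms(2) by (simp add: norm_mult mult_right_mono)
  moreover have "1 - cmod (\<zeta> * z) \<le> cmod (1 - \<zeta> * z)"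
    using norm_triangle_ineq2[of 1 "\<zeta> * z"] by simp
  ultimately show *: "1 - A * cmod z \<le> cmod (1 - \<zeta> * z)" by linarith
  then show "1 - \<zeta> * z \<noteq> 0" using assms(1) by auto
qed

text \<open>Cauchy's theorem on the boundary of the half disc of radius \<open>A\<close>. Raising
  the argument of \<open>g\<close> by \<open>\<i> * y\<close> leaves room below the diameter, so the
  integrand is holomorphic across it.\<close>

lemma half_disc_contour:
  assumes y: "y > 0" and z: "A * cmod z < 1"
  shows "integral {-A..A} (\<lambda>x. g (Complex x y) / (1 - complex_of_real x * z)) =
         - integral {0..pi} (\<lambda>t. g (A * cis t + \<i> * y) / (1 - A * cis t * z) * (A * \<i> * cis t))"
proof -
  define F where "F \<zeta> = g (\<zeta> + \<i> * y) / (1 - \<zeta> * z)" for \<zeta>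
  \<comment> \<open>The inner product is \<open>Re (\<zeta> * z)\<close>, so \<open>S\<close> is an
    intersection of two half planes that avoids the zero of \<open>1 - \<zeta> * z\<close>; it is
    convex and contains the closed half disc because \<open>A * cmod z < 1\<close>.\<close>
  define S where "S = {\<zeta>. Im \<zeta> > - y} \<inter> {\<zeta>. cnj z \<bullet> \<zeta> < 1}"
  let ?l = "linepath (- complex_of_real A) (complex_of_real A)"
  let ?c = "part_circlepath 0 A 0 pi"
  have holo_F: "F holomorphic_on S"
  proof -
    have "(\<lambda>\<zeta>. g (\<zeta> + \<i> * y)) holomorphic_on S"
      by (rule holomorphic_on_compose_gen[where g = g and t = "K ` lower", unfolded o_def])
        (use upper_subset_image in \<open>auto simp: S_def intro!: holomorphic_intros holo_g\<close>)
    moreover have "1 - \<zeta> * z \<noteq> 0" if "\<zeta> \<in> S" for \<zeta>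
    proof
      assume "1 - \<zeta> * z = 0"
      then have "Re (\<zeta> * z) = 1" by (metis eq_iff_diff_eq_0 one_complex.sel(1))
      then show False using that by (simp add: S_def inner_complex_def algebra_simps)
    qed
    ultimately show ?thesis unfolding F_def by (intro holomorphic_intros) auto
  qed
  have conv: "convex S"
    unfolding S_def by (intro convex_Int convex_halfspace_Im_gt convex_halfspace_lt)
  have inS: "\<zeta> \<in> S" if "cmod \<zeta> \<le> A" "Im \<zeta> \<ge> 0" for \<zeta>
  proof -
    have "cnj z \<bullet> \<zeta> \<le> cmod z * A"
      using norm_cauchy_schwarz[of "cnj z" \<zeta>] mult_left_mono[OF that(1), of "cmod z"] by simp
    then show ?thesis using that z y by (simp add: S_def mult.commute)
  qed
  have l: "path_image ?l \<subseteq> S"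
    by (rule closed_segment_subset[OF _ _ conv, folded path_image_linepath]) (use A in \<open>auto intro!: inS\<close>)
  have c: "path_image ?c \<subseteq> S"
  proof
    fix \<zeta> assume "\<zeta> \<in> path_image ?c"
    then obtain t where t: "t \<in> {0..pi}" "\<zeta> = A * cis t"
      by (auto simp: path_image_part_circlepath' closed_segment_eq_real_ivl)
    then show "\<zeta> \<in> S" using A sin_ge_zero[of t] by (intro inS) (auto simp: norm_mult)
  qed
  have cont: "continuous_on S F" by (rule holomorphic_on_imp_continuous_on[OF holo_F])
  have int: "F contour_integrable_on ?l" "F contour_integrable_on ?c"
    using contour_integrable_continuous_linepath contour_integrable_continuous_part_circlepath
      continuous_on_subset[OF cont] l c by (metis path_image_linepath)+
  have "(F has_contour_integral 0) (?l +++ ?c)"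
    using l c A
    by (intro Cauchy_theorem_convex_simple[OF holo_F conv])
       (auto intro!: valid_path_join simp: path_image_join)
  then have "contour_integral ?l F + contour_integral ?c F = 0"
    using int by (metis contour_integral_join contour_integral_unique valid_path_linepath valid_path_part_circlepath)
  moreover have "contour_integral ?l F = integral {-A..A} (\<lambda>x. F (of_real x))"
    using A contour_integral_linepath_Reals_eq[of "- of_real A" "of_real A" F] by simp
  moreover have "contour_integral ?c F = integral {0..pi} (\<lambda>t. F (A * cis t) * (A * \<i> * cis t))"
    using contour_integral_part_circlepath_eq[of 0 pi 0 A F] by (simp add: mult.assoc)
  ultimately show ?thesis by (simp add: F_def Complex_eq add_eq_0_iff2)
qed

text \<open>The limit of the arc integrand as the height tends to 0. It uses \<open>h\<close>
  because the endpoints \<open>A\<close> and \<open>- A\<close> lie outside the image of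
  \<open>lower\<close>, where \<open>g\<close> carries no information.\<close>

definition arc_integrand :: "complex \<Rightarrow> real \<Rightarrow> complex" where
  "arc_integrand z t = h (inverse (A * cis t)) / (1 - A * cis t * z) * (A * \<i> * cis t)"

lemma inverse_in_ball: "cmod v \<ge> A \<Longrightarrow> cmod (inverse v) < d"
  using A by (metis dual_order.strict_trans2 inverse_eq_divide le_imp_inverse_le norm_inverse)

text \<open>Raising a point of the upper arc keeps its modulus at least \<open>A\<close>, so
  \<open>g\<close> may be replaced by \<open>h\<close>, which is continuous up to the endpoints. The
  bound \<open>r\<close> on \<open>g\<close> supplies the dominating constant.\<close>

lemma arc_limit:
  fixes y :: "nat \<Rightarrow> real"
  assumes z: "A * cmod z < 1" and y: "\<And>n. y n > 0" "y \<longlonglongrightarrow> 0"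
  shows "(\<lambda>n. integral {0..pi} (\<lambda>t. g (A * cis t + \<i> * y n) / (1 - A * cis t * z) * (A * \<i> * cis t)))
           \<longlonglongrightarrow> integral {0..pi} (arc_integrand z)"
proof (rule dominated_convergence(2)[where h = "\<lambda>_. r / (1 - A * cmod z) * A"])
  have far: "cmod (A * cis t + \<i> * y n) \<ge> A" "A * cis t + \<i> * y n \<in> K ` lower" if "t \<in> {0..pi}" for t n
  proof -
    have s: "sin t \<ge> 0" using that by (simp add: sin_ge_zero)
    have "A\<^sup>2 = (A * cos t)\<^sup>2 + (A * sin t)\<^sup>2"
      by (simp add: power_mult_distrib flip: distrib_left)
    also have "\<dots> \<le> (A * cos t)\<^sup>2 + (A * sin t + y n)\<^sup>2"
      using s A y(1)[of n] by (intro add_left_mono power_mono) auto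
    also have "\<dots> = (cmod (A * cis t + \<i> * y n))\<^sup>2" by (simp add: cmod_power2)
    finally show "cmod (A * cis t + \<i> * y n) \<ge> A" by (rule power2_le_imp_le) simp
    show "A * cis t + \<i> * y n \<in> K ` lower"
      using upper_subset_image s A y(1)[of n] by (auto intro!: subsetD[OF upper_subset_image] add_nonneg_pos)
  qed
  have nz: "1 - A * cis t * z \<noteq> 0" "1 - A * cmod z \<le> cmod (1 - A * cis t * z)" for t
    using one_minus_nonzero[OF z, of "A * cis t"] A by (auto simp: norm_mult)
  have cont: "continuous_on {0..pi} (\<lambda>t. g (A * cis t + \<i> * y n))" for n
    by (rule continuous_on_compose2[OF holomorphic_on_imp_continuous_on[OF holo_g]])
       (use far in \<open>auto intro!: continuous_intros\<close>)
  show "(\<lambda>t. g (A * cis t + \<i> * y n) / (1 - A * cis t * z) * (A * \<i> * cis t)) integrable_on {0..pi}" for n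
    using nz by (intro integrable_continuous_real continuous_intros cont) auto
  show "(\<lambda>_. r / (1 - A * cmod z) * A) integrable_on {0..pi}" by (rule integrable_const_ivl)
  show "cmod (g (A * cis t + \<i> * y n) / (1 - A * cis t * z) * (A * \<i> * cis t)) \<le> r / (1 - A * cmod z) * A"
    if "t \<in> {0..pi}" for n t
  proof -
    have "cmod (g (A * cis t + \<i> * y n)) \<le> r" using g_bounds[OF far(2)[OF that]] by (simp add: less_imp_le)
    then show ?thesis using nz(2)[of t] z A r_pos
      by (auto simp: norm_mult norm_divide intro!: frac_le mult_right_mono)
  qed
  show "(\<lambda>n. g (A * cis t + \<i> * y n) / (1 - A * cis t * z) * (A * \<i> * cis t)) \<longlonglongrightarrow> arc_integrand z t"
    if t: "t \<in> {0..pi}" for t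
  proof -
    have nA: "A * cis t \<noteq> 0" using A by simp
    have "cmod (inverse (A * cis t)) < d" using A by (intro inverse_in_ball) (simp add: norm_mult)
    then have "isCont h (inverse (A * cis t))"
      using holo_h by (metis continuous_on_eq_continuous_at holomorphic_on_imp_continuous_on mem_ball_0 open_ball)
    moreover have "(\<lambda>n. inverse (A * cis t + \<i> * y n)) \<longlonglongrightarrow> inverse (A * cis t + \<i> * of_real 0)"
      using nA by (intro tendsto_intros y) simp
    ultimately have "(\<lambda>n. h (inverse (A * cis t + \<i> * y n))) \<longlonglongrightarrow> h (inverse (A * cis t))"
      by (intro isCont_tendsto_compose[where g = h]) (simp_all only: of_real_0 mult_zero_right add_0_right)
    then have "(\<lambda>n. g (A * cis t + \<i> * y n)) \<longlonglongrightarrow> h (inverse (A * cis t))"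
      using far[OF t] by (simp add: g_far)
    then show ?thesis unfolding arc_integrand_def using nz(1) by (intro tendsto_intros) auto
  qed
qed

lemma dens_far: "\<bar>x\<bar> \<ge> A \<Longrightarrow> dens x = 0"
  using real_far by (simp add: dens_def)

text \<open>The contour identity is taken at heights tending to 0: the diameter side converges by
  \<open>dens_limit\<close> under a uniform bound, the arc side by \<open>arc_limit\<close>.\<close>

lemma dens_arc_integral:
  assumes z: "A * cmod z < 1"
  shows "(\<lambda>x. dens x / (1 - complex_of_real x * z)) integrable_on {-A..A}"
    and "2 * pi * \<i> * integral {-A..A} (\<lambda>x. dens x / (1 - complex_of_real x * z)) =
         integral {0..pi} (arc_integrand z) - cnj (integral {0..pi} (arc_integrand (cnj z)))"
proof -
  define y where "y n = inverse (real (Suc n))" for n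
  have y: "y n > 0" "y \<longlonglongrightarrow> 0" for n
    unfolding y_def using LIMSEQ_inverse_real_of_nat by simp_all
  define f where "f n x = complex_of_real (- Im (g (Complex x (y n))) / pi) / (1 - complex_of_real x * z)" for n x
  define c where "c n z = integral {-A..A} (\<lambda>x. g (Complex x (y n)) / (1 - complex_of_real x * z))" for n z
  have up: "Complex x (y n) \<in> K ` lower" for n x using upper_subset_image y(1) by auto
  have nz: "1 - of_real x * z' \<noteq> 0" "1 - A * cmod z \<le> cmod (1 - of_real x * z')"
    if "x \<in> {-A..A}" "z' = z \<or> z' = cnj z" for x z'
    using one_minus_nonzero[of z' "of_real x"] that z by (auto simp: abs_le_iff)
  note cont = continuous_g_line[OF y(1)]
  have int: "(\<lambda>x. g (Complex x (y n)) / (1 - complex_of_real x * z')) integrable_on {-A..A}"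
    if "z' = z \<or> z' = cnj z" for z' n
    using nz[OF _ that] by (intro integrable_continuous_real continuous_intros cont) auto
  have fint: "f n integrable_on {-A..A}" for n
    unfolding f_def using nz by (intro integrable_continuous_real continuous_intros cont) auto
  have bound: "cmod (f n x) \<le> r / pi / (1 - A * cmod z)" if "x \<in> {-A..A}" for n x
  proof -
    have "\<bar>Im (g (Complex x (y n)))\<bar> \<le> r"
      using g_bounds[OF up[of x n]] abs_Im_le_cmod[of "g (Complex x (y n))"] by linarith
    then have "cmod (complex_of_real (- Im (g (Complex x (y n))) / pi)) \<le> r / pi"
      by (simp add: norm_divide divide_right_mono)
    then show ?thesis
      unfolding f_def norm_divide[of "complex_of_real _"] using nz(2)[OF that] z r_pos by (intro frac_le) auto
  qed
  have conv: "(\<lambda>n. f n x) \<longlonglongrightarrow> dens x / (1 - complex_of_real x * z)" if "x \<in> {-A..A}" for x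
    unfolding f_def using nz(1)[OF that] by (intro tendsto_intros dens_limit y) auto
  note dom = dominated_convergence[OF fint integrable_const_ivl bound conv]
  show "(\<lambda>x. dens x / (1 - complex_of_real x * z)) integrable_on {-A..A}" by (rule dom(1))
  have c_lim: "(\<lambda>n. c n z') \<longlonglongrightarrow> - integral {0..pi} (arc_integrand z')" if "z' = z \<or> z' = cnj z" for z'
  proof -
    have z': "A * cmod z' < 1" using z that by auto
    show ?thesis unfolding c_def half_disc_contour[OF y(1) z'] by (intro tendsto_minus arc_limit z' y)
  qed
  \<comment> \<open>Combining \<open>z\<close> with its conjugate isolates \<open>Im g\<close> although the kernel is not real.\<close>
  have "c n z - cnj (c n (cnj z)) = - (2 * pi * \<i>) * integral {-A..A} (f n)" for n
  proof -
    have "c n z - cnj (c n (cnj z)) =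
        integral {-A..A} (\<lambda>x. g (Complex x (y n)) / (1 - complex_of_real x * z)
           - cnj (g (Complex x (y n)) / (1 - complex_of_real x * cnj z)))"
      unfolding c_def integral_cnj
      by (rule Henstock_Kurzweil_Integration.integral_diff[symmetric])
         (intro int integrable_on_cnj_iff[THEN iffD2], simp)+
    also have "\<dots> = integral {-A..A} (\<lambda>x. - (2 * pi * \<i>) * f n x)"
    proof (rule arg_cong[where f = "integral _"], rule ext)
      fix x
      have "g (Complex x (y n)) - cnj (g (Complex x (y n))) = 2 * \<i> * Im (g (Complex x (y n)))"
        by (simp add: complex_eq_iff)
      then show "g (Complex x (y n)) / (1 - complex_of_real x * z)
           - cnj (g (Complex x (y n)) / (1 - complex_of_real x * cnj z)) = - (2 * pi * \<i>) * f n x"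
        by (simp add: f_def flip: diff_divide_distrib)
    qed
    finally show ?thesis by simp
  qed
  then have "(\<lambda>n. c n z - cnj (c n (cnj z))) \<longlonglongrightarrow>
      - (2 * pi * \<i>) * integral {-A..A} (\<lambda>x. dens x / (1 - complex_of_real x * z))"
    by (simp only:) (intro tendsto_mult tendsto_const dom(2))
  moreover have "(\<lambda>n. c n z - cnj (c n (cnj z))) \<longlonglongrightarrow>
      - integral {0..pi} (arc_integrand z) - cnj (- integral {0..pi} (arc_integrand (cnj z)))"
    by (intro tendsto_diff tendsto_cnj c_lim) simp_all
  ultimately have "- (2 * pi * \<i>) * integral {-A..A} (\<lambda>x. dens x / (1 - complex_of_real x * z)) =
      - integral {0..pi} (arc_integrand z) - cnj (- integral {0..pi} (arc_integrand (cnj z)))"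
    by (rule LIMSEQ_unique)
  moreover have "a * b = c - cnj d" if "- a * b = - c - cnj (- d)" for a b c d :: complex
    using arg_cong[OF that, of uminus] by simp
  ultimately show "2 * pi * \<i> * integral {-A..A} (\<lambda>x. dens x / (1 - complex_of_real x * z)) =
         integral {0..pi} (arc_integrand z) - cnj (integral {0..pi} (arc_integrand (cnj z)))"
    by blast
qed

text \<open>Under \<open>v = 1 / \<zeta>\<close> the first arc becomes the lower half, and the
  conjugated arc the upper half, of the circle of radius \<open>1 / A\<close>. Together they form a
  full Cauchy integral of \<open>q\<close>, evaluated at \<open>z\<close>.\<close>

lemma arcs_to_circle:
  assumes z: "A * cmod z < 1"
  shows "integral {0..pi} (arc_integrand z) - cnj (integral {0..pi} (arc_integrand (cnj z))) =
         2 * pi * \<i> * (1 + h z * H (h z))"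
proof -
  define q where "q v = 1 + h v * H (h v)" for v
  define \<Psi> where "\<Psi> t = q (inverse A * cis t) / (inverse A * cis t - z) * (inverse A * \<i> * cis t)" for t
  have zA: "cmod z < inverse A" using z A by (simp add: field_simps)
  have inb: "cball 0 (inverse A) \<subseteq> ball 0 d" using A by (auto simp: inverse_eq_divide)
  have "q holomorphic_on ball 0 d"
  proof -
    have "H \<circ> h holomorphic_on ball 0 d"
      by (rule holomorphic_on_compose_gen[OF holo_h holo_H])
         (use h_less r_less in \<open>fastforce\<close>)
    then show ?thesis unfolding q_def by (intro holomorphic_intros holo_h) (simp add: o_def)
  qed
  then have holo_q: "q holomorphic_on cball 0 (inverse A)" using inb by (rule holomorphic_on_subset)
  have ne: "inverse A * cis t - z \<noteq> 0" for t
  proof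
    assume "inverse A * cis t - z = 0"
    then have "cmod z = cmod (inverse A * cis t)" by simp
    then show False using zA A by (simp add: norm_mult norm_inverse)
  qed
  have cont: "continuous_on {0..2*pi} \<Psi>"
  proof -
    have "continuous_on {0..2*pi} (\<lambda>t. q (inverse A * cis t))"
      by (rule continuous_on_compose2[OF holomorphic_on_imp_continuous_on[OF holo_q]])
         (use A in \<open>auto intro!: continuous_intros simp: norm_mult norm_inverse\<close>)
    then show ?thesis unfolding \<Psi>_def using ne by (intro continuous_intros) auto
  qed
  \<comment> \<open>The factor \<open>v\<close> in \<open>h v = v * q v\<close> cancels the pole at
    0 that the substitution creates, leaving the Cauchy kernel at \<open>z\<close>.\<close>
  have kernel: "h v / (1 - inverse v * z) * (\<i> * inverse v) = q v / (v - z) * (\<i> * v)"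
    if "cmod v = inverse A" for v
  proof -
    have "v \<noteq> 0" "v \<noteq> z" "cmod v < d" using that A zA by (auto simp: inverse_eq_divide)
    moreover have "h v = v * q v" using h_eq[OF \<open>cmod v < d\<close>] by (simp add: q_def)
    ultimately show ?thesis by (simp add: field_simps)
  qed
  have upper: "arc_integrand z t = \<Psi> (2 * pi - t)" for t
  proof -
    define v where "v = inverse (A * cis t)"
    have v: "inverse (A * cis t) = v" "A * cis t = inverse v" "A * \<i> * cis t = \<i> * inverse v"
      by (simp_all add: v_def)
    have nv: "cmod v = inverse A" using A by (simp add: v_def norm_mult norm_inverse)
    have "arc_integrand z t = q v / (v - z) * (\<i> * v)"
      using kernel[OF nv] by (simp only: arc_integrand_def v inverse_inverse_eq)
    moreover have "cis (- t) = cis (2 * pi - t)" by (simp add: complex_eq_iff cos_diff sin_diff)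
    then have "v = inverse A * cis (2 * pi - t)" by (simp add: v_def)
    ultimately show ?thesis by (simp add: \<Psi>_def mult_ac)
  qed
  have lower: "- cnj (arc_integrand (cnj z) t) = \<Psi> t" for t
  proof -
    define v where "v = inverse A * cis t"
    have v: "inverse (A * cis t) = cnj v" "A * cis t = cnj (inverse v)" "A * \<i> * cis t = \<i> * cnj (inverse v)"
      by (simp_all add: v_def cis_cnj)
    have nv: "cmod v = inverse A" using A by (simp add: v_def norm_mult norm_inverse)
    then have "h (cnj v) = cnj (h v)" using A by (intro h_cnj) (simp add: inverse_eq_divide)
    then have "- cnj (arc_integrand (cnj z) t) = h v / (1 - inverse v * z) * (\<i> * inverse v)"
      unfolding arc_integrand_def v by simp
    also have "\<dots> = q v / (v - z) * (\<i> * v)" by (rule kernel[OF nv])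
    also have "\<dots> = \<Psi> t" by (simp add: \<Psi>_def v_def mult_ac)
    finally show ?thesis .
  qed
  have "integral {0..pi} (arc_integrand z) = integral {0..pi} (\<lambda>t. \<Psi> (2 * pi - t))"
    using upper by presburger
  also have "\<dots> = integral {-pi..0} (\<lambda>t. \<Psi> (t + 2 * pi))"
    using Henstock_Kurzweil_Integration.integral_reflect_real[of pi 0 "\<lambda>t. \<Psi> (2 * pi - t)"] by (simp add: add.commute)
  also have "\<dots> = integral {pi..2 * pi} \<Psi>"
    using integral_shift_real_ivl[of pi "2 * pi" "2 * pi" \<Psi>] by simp
  finally have 1: "integral {0..pi} (arc_integrand z) = integral {pi..2 * pi} \<Psi>" .
  have 2: "- cnj (integral {0..pi} (arc_integrand (cnj z))) = integral {0..pi} \<Psi>"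
    unfolding integral_cnj lower[symmetric] by simp
  have "contour_integral (circlepath 0 (inverse A)) (\<lambda>v. q v / (v - z)) = integral {0..2*pi} \<Psi>"
    unfolding circlepath_def \<Psi>_def
    using contour_integral_part_circlepath_eq[of 0 "2 * pi" 0 "inverse A" "\<lambda>v. q v / (v - z)"]
    by (simp add: mult.assoc)
  moreover have "contour_integral (circlepath 0 (inverse A)) (\<lambda>v. q v / (v - z)) = 2 * pi * \<i> * q z"
    using Cauchy_integral_circlepath_simple[OF holo_q, of z] zA by (intro contour_integral_unique) simp
  moreover have "integral {0..pi} \<Psi> + integral {pi..2*pi} \<Psi> = integral {0..2*pi} \<Psi>"
    by (intro Henstock_Kurzweil_Integration.integral_combine integrable_continuous_real cont) auto
  moreover have "integral {0..pi} (arc_integrand z) - cnj (integral {0..pi} (arc_integrand (cnj z))) =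
      integral {0..pi} \<Psi> + integral {pi..2*pi} \<Psi>"
    unfolding diff_conv_add_uminus 1 2 by (rule add.commute)
  ultimately show ?thesis by (simp only: q_def)
qed

lemma dens_moment_integral:
  assumes z: "A * cmod z < 1"
  shows "integral {-A..A} (\<lambda>x. dens x / (1 - complex_of_real x * z)) = 1 + h z * H (h z)"
  using dens_arc_integral(2)[OF z] arcs_to_circle[OF z]
  by simp

section \<open>The distribution with density \<open>dens\<close>\<close>

lemma dens_measurable [measurable]: "dens \<in> borel_measurable borel"
proof (rule borel_measurable_LIMSEQ_real)
  define y where "y n = inverse (real (Suc n))" for n
  have y: "y n > 0" "y \<longlonglongrightarrow> 0" for n
    unfolding y_def using LIMSEQ_inverse_real_of_nat by simp_all
  show "(\<lambda>n. - Im (g (Complex x (y n))) / pi) \<longlonglongrightarrow> dens x" for x by (rule dens_limit[OF y])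
  show "(\<lambda>x. - Im (g (Complex x (y n))) / pi) \<in> borel_measurable borel" for n
    by (intro borel_measurable_continuous_onI continuous_intros continuous_g_line y) auto
qed

text \<open>Passes from the gauge integral over a compact interval to the Lebesgue integral over the
  line, using that \<open>dens\<close> is bounded and vanishes outside the interval.\<close>

lemma dens_lborel_integral:
  assumes z: "A * cmod z < 1"
  shows "integrable lborel (\<lambda>x. dens x *\<^sub>R (1 / (1 - complex_of_real x * z)))"
    and "(LINT x|lborel. dens x *\<^sub>R (1 / (1 - complex_of_real x * z))) = 1 + h z * H (h z)"
proof -
  have eq: "dens x *\<^sub>R (1 / (1 - complex_of_real x * z)) =
      indicator {-A..A} x *\<^sub>R (dens x / (1 - complex_of_real x * z))" for x
  proof (cases "x \<in> {-A..A}")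
    case False
    then have "dens x = 0" by (intro dens_far) auto
    with False show ?thesis by simp
  qed (simp add: scaleR_conv_of_real)
  have int: "set_integrable lborel {-A..A} (\<lambda>x. dens x / (1 - complex_of_real x * z))"
    unfolding set_integrable_def
  proof (rule integrableI_bounded_set_indicator[where B = "r / pi / (1 - A * cmod z)"])
    show "AE x in lborel. x \<in> {-A..A} \<longrightarrow> cmod (dens x / (1 - complex_of_real x * z)) \<le> r / pi / (1 - A * cmod z)"
    proof (intro AE_I2 impI)
      fix x assume "x \<in> {-A..A}"
      then have "1 - A * cmod z \<le> cmod (1 - complex_of_real x * z)"
        using one_minus_nonzero(2)[OF z, of "of_real x"] by auto
      then show "cmod (dens x / (1 - complex_of_real x * z)) \<le> r / pi / (1 - A * cmod z)"
        using z dens_bounds[of x] unfolding norm_divide by (intro frac_le) auto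
    qed
  qed (auto simp: emeasure_lborel_Icc_eq)
  show "integrable lborel (\<lambda>x. dens x *\<^sub>R (1 / (1 - complex_of_real x * z)))"
    using int unfolding set_integrable_def eq .
  show "(LINT x|lborel. dens x *\<^sub>R (1 / (1 - complex_of_real x * z))) = 1 + h z * H (h z)"
    using set_borel_integral_eq_integral(2)[OF int] dens_moment_integral[OF z]
    unfolding set_lebesgue_integral_def eq by simp
qed

text \<open>The moment transform is \<open>1 + h z * H (h z)\<close>, so \<open>h_eq\<close> says
  that \<open>h z\<close> is \<open>z\<close> times the moment transform. Substituting this back
  gives the defining equation of the R-transform. The case \<open>z = 0\<close>, where
  \<open>h 0 = 0\<close>, gives total mass 1.\<close>

lemma free_distribution_local:
  defines "\<mu> \<equiv> density lborel (\<lambda>x. ennreal (dens x))"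
  shows "compactly_supported_distribution \<mu>" "is_free_R_transform \<mu> (\<lambda>w. w * H w)"
proof -
  have h0: "h 0 = 0" using h_eq[of 0] A by (simp add: order.strict_trans[of 0 "1 / A"])
  have mom: "moment_transform \<mu> z = 1 + h z * H (h z)" if "A * cmod z < 1" for z
    unfolding moment_transform_def \<mu>_def
    using dens_lborel_integral(2)[OF that] dens_bounds(1) by (subst integral_density) auto
  have "integrable lborel (\<lambda>x. complex_of_real (dens x))" "(LINT x|lborel. complex_of_real (dens x)) = 1"
    using dens_lborel_integral[of 0] h0 by (simp_all add: scaleR_conv_of_real)
  then have "integrable lborel dens" "(LINT x|lborel. dens x) = 1"
    by (simp_all only: complex_of_real_integrable_eq integral_complex_of_real of_real_eq_1_iff)
  then have "(\<integral>\<^sup>+x. ennreal (dens x) \<partial>lborel) = 1"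
    using dens_bounds(1) by (subst nn_integral_eq_integral) auto
  then have "prob_space \<mu>"
    by (intro prob_spaceI) (simp add: \<mu>_def emeasure_density)
  then have "real_distribution \<mu>"
    by (intro real_distribution.intro real_distribution_axioms.intro) (simp_all add: \<mu>_def)
  moreover have "AE x in \<mu>. x \<in> {-A..A}"
  proof -
    have "x \<in> {-A..A}" if "0 < ennreal (dens x)" for x
    proof -
      have "\<bar>x\<bar> < A" using that dens_far[of x] by (cases "\<bar>x\<bar> < A") auto
      then show ?thesis by auto
    qed
    then show ?thesis unfolding \<mu>_def by (subst AE_density) auto
  qed
  ultimately show "compactly_supported_distribution \<mu>"
    unfolding compactly_supported_distribution_def by blast
  have "(\<lambda>w. w * H w) analytic_on {0}"
    using r_pos r_less
    by (intro holomorphic_on_imp_analytic_at[of _ "ball 0 s"] holomorphic_intros holo_H) auto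
  moreover have "\<forall>\<^sub>F z in nhds 0. 1 + z * moment_transform \<mu> z * H (z * moment_transform \<mu> z) = moment_transform \<mu> z"
  proof -
    have "\<forall>\<^sub>F z in nhds 0. z \<in> ball 0 (1 / A)"
      using A by (intro eventually_nhds_in_open) auto
    then show ?thesis
    proof eventually_elim
      case (elim z)
      then have "cmod z < 1 / A" by simp
      then have "A * cmod z < 1" "cmod z < d" using A by (simp add: field_simps, linarith)
      then show ?case using mom h_eq by metis
    qed
  qed
  ultimately show "is_free_R_transform \<mu> (\<lambda>w. w * H w)" by (simp add: is_free_R_transform_def)
qed

end

theorem exists_free_distribution:
  "\<exists>\<mu>. compactly_supported_distribution \<mu> \<and> is_free_R_transform \<mu> (\<lambda>w. w * H w)"
proof (rule inverse_near_infinity)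
  fix A d :: real and h :: "complex \<Rightarrow> complex"
  assume "A > 0" "1 / A < d" "h holomorphic_on ball 0 d"
    "\<And>v. cmod v < d \<Longrightarrow> cmod (h v) < r"
    "\<And>v. cmod v < d \<Longrightarrow> h v = v * (1 + h v * H (h v))"
    "\<And>v. cmod v < d \<Longrightarrow> h (cnj v) = cnj (h v)"
    "\<And>z. z \<in> K ` lower \<Longrightarrow> cmod z \<ge> A \<Longrightarrow> g z = h (inverse z)"
    "\<And>x::real. \<bar>x\<bar> \<ge> A \<Longrightarrow> complex_of_real x \<notin> K ` lower"
  note * = this
  show ?thesis using free_distribution_local[OF *] by blast
qed

end

section \<open>The power series with coefficients \<open>n^k\<close>\<close>

text \<open>A ratio test; the shift to \<open>Suc n\<close> reflects that \<open>H\<close> is the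
  R-transform divided by \<open>w\<close>.\<close>

lemma conv_radius_power_Suc: "conv_radius (\<lambda>n. complex_of_real (real (Suc n) ^ k)) = 1"
proof -
  have "(\<lambda>n. real (Suc n) / real (Suc (Suc n))) \<longlonglongrightarrow> 1"
    by real_asymp
  then have "(\<lambda>n. (real (Suc n) / real (Suc (Suc n))) ^ k) \<longlonglongrightarrow> 1 ^ k"
    by (rule tendsto_power)
  then have "conv_radius (\<lambda>n. complex_of_real (real (Suc n) ^ k)) = ereal 1"
    by (intro conv_radius_ratio_limit_nonzero) 
       (auto simp: norm_divide norm_power power_divide simp flip: of_nat_Suc)
  then show ?thesis by simp
qed

lemma summable_power_Suc:
  assumes "cmod w < 1"
  shows "summable (\<lambda>n. complex_of_real (real (Suc n) ^ k) * w ^ n)"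
proof (rule summable_in_conv_radius)
  show "ereal (cmod w) < conv_radius (\<lambda>n. complex_of_real (real (Suc n) ^ k))"
    unfolding conv_radius_power_Suc using assms by simp
qed

text \<open>The common majorant of the tail estimates. The shift by 3 matches a tail that starts
  with the term \<open>3 ^ k * w ^ 2\<close>.\<close>

lemma summable_power_half: "summable (\<lambda>n. real (n + 3) ^ k * (1 / 2) ^ n)"
proof -
  have "summable (\<lambda>n. complex_of_real (real (Suc n) ^ k) * complex_of_real (1 / 2) ^ n)"
    by (rule summable_power_Suc) simp
  then have "summable (\<lambda>n. real (Suc n) ^ k * (1 / 2) ^ n)"
    unfolding of_real_power[symmetric] of_real_mult[symmetric] summable_complex_of_real .
  then have "summable (\<lambda>n. real (Suc (n + 2)) ^ k * (1 / 2) ^ (n + 2))"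
    by (rule summable_ignore_initial_segment)
  from summable_mult[OF this, of 4] show ?thesis
    by (simp add: power_add algebra_simps)
qed

section \<open>Bounds proportional to imaginary parts\<close>

lemma Im_of_real_mult: "Im (complex_of_real c * z) = c * Im z"
  by simp

text \<open>The factor \<open>r\<close> on the left avoids the exponent \<open>a - 1\<close>, which is truncated at \<open>a = 0\<close>.\<close>
lemma Im_power_bound:
  assumes "cmod x \<le> r"
  shows "\<bar>Im (x ^ a)\<bar> * r \<le> real a * r ^ a * \<bar>Im x\<bar>"
proof (induction a)
  case (Suc a)
  have r: "r \<ge> 0" using assms norm_ge_zero order_trans by blast
  have "\<bar>Im (x ^ Suc a)\<bar> \<le> \<bar>Re x\<bar> * \<bar>Im (x ^ a)\<bar> + \<bar>Im x\<bar> * \<bar>Re (x ^ a)\<bar>"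
    using abs_triangle_ineq[of "Re x * Im (x ^ a)" "Im x * Re (x ^ a)"] by (simp add: abs_mult)
  also have "\<dots> \<le> r * \<bar>Im (x ^ a)\<bar> + \<bar>Im x\<bar> * r ^ a"
  proof (intro add_mono mult_mono order_refl)
    show "\<bar>Re x\<bar> \<le> r" using abs_Re_le_cmod[of x] assms by linarith
    have "cmod (x ^ a) \<le> r ^ a" unfolding norm_power by (intro power_mono assms) simp
    then show "\<bar>Re (x ^ a)\<bar> \<le> r ^ a" using abs_Re_le_cmod[of "x ^ a"] by linarith
  qed (use r in auto)
  finally have "\<bar>Im (x ^ Suc a)\<bar> * r \<le> (r * \<bar>Im (x ^ a)\<bar> + \<bar>Im x\<bar> * r ^ a) * r"
    using r by (intro mult_right_mono)
  also have "\<dots> = r * (\<bar>Im (x ^ a)\<bar> * r) + \<bar>Im x\<bar> * r ^ Suc a" by (simp add: algebra_simps)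
  also have "\<dots> \<le> r * (real a * r ^ a * \<bar>Im x\<bar>) + \<bar>Im x\<bar> * r ^ Suc a"
    using r Suc.IH by (intro add_right_mono mult_left_mono)
  also have "\<dots> = real (Suc a) * r ^ Suc a * \<bar>Im x\<bar>" by (simp add: algebra_simps)
  finally show ?case .
qed simp

text \<open>Linearity in the imaginary parts is the point: it lets these terms be compared with the
  main terms however close \<open>x\<close> and \<open>y\<close> come to the real axis.\<close>

lemma Im_power_mult_bound:
  assumes "cmod x \<le> r" "cmod y \<le> r"
  shows "\<bar>Im (x ^ a * y ^ b)\<bar> * r \<le> r ^ (a + b) * (real a * \<bar>Im x\<bar> + real b * \<bar>Im y\<bar>)"
proof -
  have r: "r \<ge> 0" using assms norm_ge_zero order_trans by blast
  have "cmod (x ^ a) \<le> r ^ a" "cmod (y ^ b) \<le> r ^ b"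
    unfolding norm_power by (auto intro!: power_mono assms)
  then have re: "\<bar>Re (x ^ a)\<bar> \<le> r ^ a" "\<bar>Re (y ^ b)\<bar> \<le> r ^ b"
    using abs_Re_le_cmod order_trans by blast+
  have "\<bar>Im (x ^ a * y ^ b)\<bar> \<le> \<bar>Re (x ^ a)\<bar> * \<bar>Im (y ^ b)\<bar> + \<bar>Im (x ^ a)\<bar> * \<bar>Re (y ^ b)\<bar>"
    using abs_triangle_ineq[of "Re (x ^ a) * Im (y ^ b)" "Im (x ^ a) * Re (y ^ b)"] by (simp add: abs_mult)
  also have "\<dots> \<le> r ^ a * \<bar>Im (y ^ b)\<bar> + \<bar>Im (x ^ a)\<bar> * r ^ b"
    using re r by (intro add_mono mult_mono) auto
  finally have "\<bar>Im (x ^ a * y ^ b)\<bar> * r \<le> (r ^ a * \<bar>Im (y ^ b)\<bar> + \<bar>Im (x ^ a)\<bar> * r ^ b) * r"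
    using r by (intro mult_right_mono)
  also have "\<dots> = r ^ a * (\<bar>Im (y ^ b)\<bar> * r) + r ^ b * (\<bar>Im (x ^ a)\<bar> * r)" by (simp add: algebra_simps)
  also have "\<dots> \<le> r ^ a * (real b * r ^ b * \<bar>Im y\<bar>) + r ^ b * (real a * r ^ a * \<bar>Im x\<bar>)"
    using r assms by (intro add_mono mult_left_mono Im_power_bound) auto
  also have "\<dots> = r ^ (a + b) * (real a * \<bar>Im x\<bar> + real b * \<bar>Im y\<bar>)"
    by (simp add: power_add algebra_simps)
  finally show ?thesis .
qed

text \<open>The sum is the divided difference of the monomial of degree \<open>n + 2\<close>. It has
  \<open>n + 2\<close> terms, and each contributes at most another factor \<open>n + 2\<close>,
  which explains the square.\<close>

lemma Im_divided_difference_bound: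
  assumes "cmod x \<le> r" "cmod y \<le> r" "0 < r" "r \<le> 1 / 2"
  shows "\<bar>Im (y * (\<Sum>i<n + 2. y ^ (n + 2 - Suc i) * x ^ i))\<bar>
           \<le> r * real (n + 3) ^ 2 * (1 / 2) ^ n * (\<bar>Im x\<bar> + \<bar>Im y\<bar>)"
proof -
  let ?T = "\<bar>Im x\<bar> + \<bar>Im y\<bar>"
  have "y * (\<Sum>i<n + 2. y ^ (n + 2 - Suc i) * x ^ i) = (\<Sum>i<n + 2. y ^ (n + 2 - i) * x ^ i)"
    unfolding sum_distrib_left
  proof (rule sum.cong)
    fix i assume "i \<in> {..<n + 2}"
    then have "n + 2 - i = Suc (n + 2 - Suc i)" by auto
    then show "y * (y ^ (n + 2 - Suc i) * x ^ i) = y ^ (n + 2 - i) * x ^ i"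
      by (metis mult.assoc power_Suc)
  qed simp
  then have "\<bar>Im (y * (\<Sum>i<n + 2. y ^ (n + 2 - Suc i) * x ^ i))\<bar> * r \<le>
      (\<Sum>i<n + 2. \<bar>Im (y ^ (n + 2 - i) * x ^ i)\<bar>) * r"
    using assms(3) by (simp only: Im_sum) (intro mult_right_mono sum_abs, simp)
  also have "\<dots> \<le> (\<Sum>i<n + 2. r ^ (n + 2) * (real (n + 2) * ?T))"
    unfolding sum_distrib_right
  proof (rule sum_mono)
    fix i assume i: "i \<in> {..<n + 2}"
    have "\<bar>Im (y ^ (n + 2 - i) * x ^ i)\<bar> * r \<le> r ^ (n + 2 - i + i) * (real (n + 2 - i) * \<bar>Im y\<bar> + real i * \<bar>Im x\<bar>)"
      by (rule Im_power_mult_bound[OF assms(2,1)])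
    also have "\<dots> \<le> r ^ (n + 2 - i + i) * (real (n + 2) * \<bar>Im y\<bar> + real (n + 2) * \<bar>Im x\<bar>)"
      using i assms(3) by (intro mult_left_mono add_mono mult_right_mono) auto
    also have "\<dots> = r ^ (n + 2) * (real (n + 2) * ?T)" using i by (simp add: algebra_simps)
    finally show "\<bar>Im (y ^ (n + 2 - i) * x ^ i)\<bar> * r \<le> r ^ (n + 2) * (real (n + 2) * ?T)" .
  qed
  also have "\<dots> = (real (n + 2) ^ 2 * (r * r ^ n) * ?T) * r"
    by (simp add: power2_eq_square algebra_simps)
  \<comment> \<open>Only \<open>r ^ n\<close> is replaced by a power of \<open>1 / 2\<close>; the
    remaining factor \<open>r\<close> is what makes the whole tail small.\<close>
  also have "\<dots> \<le> (real (n + 3) ^ 2 * (r * (1 / 2) ^ n) * ?T) * r"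
    using assms(3,4) by (intro mult_right_mono mult_mono power_mono mult_left_mono) auto
  finally show ?thesis using assms(3) by (simp add: mult_ac)
qed

text \<open>What remains of the series \<open>H / C\<close> after its constant term 1 and linear
  term \<open>2 ^ k * w\<close>.\<close>

definition tail :: "nat \<Rightarrow> complex \<Rightarrow> complex" where
  "tail k w = (\<Sum>n. complex_of_real (real (n + 3) ^ k) * w ^ (n + 2))"

lemma tail_sums:
  assumes "cmod w < 1"
  shows "(\<lambda>n. complex_of_real (real (n + 3) ^ k) * w ^ (n + 2)) sums tail k w"
  using summable_ignore_initial_segment[OF summable_power_Suc[OF assms, of k], of 2]
  by (simp add: tail_def summable_sums add.commute numeral_3_eq_3)

lemma abs_suminf_weighted_bound:
  fixes a b :: "nat \<Rightarrow> real"
  assumes "a sums l" "\<And>n. \<bar>a n\<bar> \<le> b n" "summable b"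
  shows "\<bar>l\<bar> \<le> suminf b"
proof -
  have "summable (\<lambda>n. \<bar>a n\<bar>)"
    by (rule summable_comparison_test[OF _ assms(3)]) (use assms(2) in auto)
  then have "\<bar>suminf a\<bar> \<le> (\<Sum>n. \<bar>a n\<bar>)" by (rule summable_rabs)
  also have "\<dots> \<le> suminf b" by (intro suminf_le assms \<open>summable (\<lambda>n. \<bar>a n\<bar>)\<close>)
  finally show ?thesis using assms(1) by (simp add: sums_iff)
qed

text \<open>Summing the monomial bounds against the coefficients raises the exponent from
  \<open>k\<close> to \<open>k + 2\<close>. The extra factor \<open>y\<close> is present because
  injectivity is tested on an equation for \<open>inverse x\<close> alone.\<close>

lemma tail_divided_difference:
  assumes "cmod x \<le> r" "cmod y \<le> r" "0 < r" "r \<le> 1 / 2" "x \<noteq> y"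
  shows "\<bar>Im (y * ((tail k x - tail k y) / (x - y)))\<bar>
           \<le> r * (\<Sum>n. real (n + 3) ^ (k + 2) * (1 / 2) ^ n) * (\<bar>Im x\<bar> + \<bar>Im y\<bar>)"
proof -
  define q where "q n = y * (\<Sum>i<n + 2. y ^ (n + 2 - Suc i) * x ^ i)" for n
  let ?T = "\<bar>Im x\<bar> + \<bar>Im y\<bar>"
  have "(\<lambda>n. y / (x - y) * (complex_of_real (real (n + 3) ^ k) * x ^ (n + 2) - complex_of_real (real (n + 3) ^ k) * y ^ (n + 2)))
          sums (y / (x - y) * (tail k x - tail k y))"
    by (intro sums_mult sums_diff tail_sums) (use assms in auto)
  moreover have "y / (x - y) * (complex_of_real (real (n + 3) ^ k) * x ^ (n + 2) - complex_of_real (real (n + 3) ^ k) * y ^ (n + 2))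
      = complex_of_real (real (n + 3) ^ k) * q n" for n
  proof -
    have "complex_of_real (real (n + 3) ^ k) * x ^ (n + 2) - complex_of_real (real (n + 3) ^ k) * y ^ (n + 2)
      = complex_of_real (real (n + 3) ^ k) * ((x - y) * (\<Sum>i<n + 2. y ^ (n + 2 - Suc i) * x ^ i))"
      by (simp only: power_diff_sumr2 flip: right_diff_distrib)
    then show ?thesis using assms(5) by (simp add: q_def)
  qed
  ultimately have "(\<lambda>n. Im (complex_of_real (real (n + 3) ^ k) * q n)) sums Im (y / (x - y) * (tail k x - tail k y))"
    by (simp only: sums_Im)
  then have "\<bar>Im (y / (x - y) * (tail k x - tail k y))\<bar> \<le> (\<Sum>n. r * ?T * (real (n + 3) ^ (k + 2) * (1 / 2) ^ n))"
  proof (rule abs_suminf_weighted_bound)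
    fix n
    have "\<bar>Im (complex_of_real (real (n + 3) ^ k) * q n)\<bar> = real (n + 3) ^ k * \<bar>Im (q n)\<bar>"
      by (simp only: Im_of_real_mult abs_mult abs_of_nonneg[OF zero_le_power[OF of_nat_0_le_iff]])
    also have "\<dots> \<le> real (n + 3) ^ k * (r * real (n + 3) ^ 2 * (1 / 2) ^ n * ?T)"
      unfolding q_def by (intro mult_left_mono Im_divided_difference_bound assms) auto
    finally show "\<bar>Im (complex_of_real (real (n + 3) ^ k) * q n)\<bar> \<le> r * ?T * (real (n + 3) ^ (k + 2) * (1 / 2) ^ n)"
      by (simp only: power_add mult_ac)
  qed (intro summable_mult summable_power_half)
  also have "\<dots> = r * ?T * (\<Sum>n. real (n + 3) ^ (k + 2) * (1 / 2) ^ n)"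
    by (intro suminf_mult summable_power_half)
  finally show ?thesis by (simp add: mult_ac)
qed

lemma tail_cnj:
  assumes "cmod w < 1"
  shows "tail k (cnj w) = cnj (tail k w)"
proof (rule sums_unique2)
  show "(\<lambda>n. cnj (complex_of_real (real (n + 3) ^ k) * w ^ (n + 2))) sums cnj (tail k w)"
    unfolding sums_cnj by (rule tail_sums[OF assms])
  show "(\<lambda>n. cnj (complex_of_real (real (n + 3) ^ k) * w ^ (n + 2))) sums tail k (cnj w)"
    using tail_sums[of "cnj w" k] assms by simp
qed

text \<open>Needed on the arc. The bound is weakened to the constant of
  \<open>tail_divided_difference\<close>, so that one choice of \<open>r\<close> serves
  both.\<close>

lemma tail_Im_bound:
  assumes "cmod w \<le> r" "0 < r" "r \<le> 1 / 2"
  shows "\<bar>Im (tail k w)\<bar> \<le> r * (\<Sum>n. real (n + 3) ^ (k + 2) * (1 / 2) ^ n) * \<bar>Im w\<bar>"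
proof -
  have "(\<lambda>n. Im (complex_of_real (real (n + 3) ^ k) * w ^ (n + 2))) sums Im (tail k w)"
    using assms by (intro sums_Im tail_sums) auto
  then have "\<bar>Im (tail k w)\<bar> \<le> (\<Sum>n. r * \<bar>Im w\<bar> * (real (n + 3) ^ (k + 2) * (1 / 2) ^ n))"
  proof (rule abs_suminf_weighted_bound)
    fix n
    have "\<bar>Im (w ^ (n + 2))\<bar> * r \<le> (real (n + 2) * (r * r ^ n) * \<bar>Im w\<bar>) * r"
      using Im_power_bound[OF assms(1), of "n + 2"] by (simp only: power_add power2_eq_square mult_ac)
    then have "\<bar>Im (w ^ (n + 2))\<bar> \<le> real (n + 2) * (r * r ^ n) * \<bar>Im w\<bar>"
      using assms(2) by (rule mult_right_le_imp_le)
    also have "\<dots> \<le> real (n + 3) ^ 2 * (r * (1 / 2) ^ n) * \<bar>Im w\<bar>"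
    proof (intro mult_right_mono mult_mono mult_left_mono power_mono)
      show "real (n + 2) \<le> real (n + 3) ^ 2" by (simp add: power2_eq_square algebra_simps)
    qed (use assms in auto)
    finally have "\<bar>Im (w ^ (n + 2))\<bar> \<le> real (n + 3) ^ 2 * (r * (1 / 2) ^ n) * \<bar>Im w\<bar>" .
    then have "real (n + 3) ^ k * \<bar>Im (w ^ (n + 2))\<bar> \<le> real (n + 3) ^ k * (real (n + 3) ^ 2 * (r * (1 / 2) ^ n) * \<bar>Im w\<bar>)"
      by (intro mult_left_mono) auto
    moreover have "\<bar>Im (complex_of_real (real (n + 3) ^ k) * w ^ (n + 2))\<bar> = real (n + 3) ^ k * \<bar>Im (w ^ (n + 2))\<bar>"
      by (simp only: Im_of_real_mult abs_mult abs_of_nonneg[OF zero_le_power[OF of_nat_0_le_iff]])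
    ultimately show "\<bar>Im (complex_of_real (real (n + 3) ^ k) * w ^ (n + 2))\<bar> \<le> r * \<bar>Im w\<bar> * (real (n + 3) ^ (k + 2) * (1 / 2) ^ n)"
      by (simp only: power_add mult_ac)
  qed (intro summable_mult summable_power_half)
  also have "\<dots> = r * \<bar>Im w\<bar> * (\<Sum>n. real (n + 3) ^ (k + 2) * (1 / 2) ^ n)"
    by (intro suminf_mult summable_power_half)
  finally show ?thesis by (simp add: mult_ac)
qed

lemma head_tail_sums:
  assumes "cmod w < 1"
  shows "(\<lambda>n. complex_of_real (real (Suc n) ^ k) * w ^ n) sums (1 + 2 ^ k * w + tail k w)"
proof -
  have "(\<lambda>n. complex_of_real (real (Suc (n + 2)) ^ k) * w ^ (n + 2)) sums tail k w"
    using tail_sums[OF assms, of k] by (simp add: numeral_3_eq_3)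
  then show ?thesis
    by (subst (asm) sums_iff_shift[of "\<lambda>n. complex_of_real (real (Suc n) ^ k) * w ^ n" 2 "tail k w"])
       (simp add: numeral_2_eq_2 add_ac)
qed

section \<open>Choice of the constants and verification of univalence\<close>

theorem theorem7p2:
  fixes k :: nat
  assumes "k \<ge> 1"
  shows "\<exists>C::real. C > 0 \<and>
    (\<exists>\<mu>. compactly_supported_distribution \<mu> \<and>
         has_free_cumulants \<mu> (\<lambda>n. C * real n ^ k))"
proof -
  define S where "S = (\<Sum>n. real (n + 3) ^ (k + 2) * (1 / 2) ^ n)"
  have "S > 0"
    unfolding S_def by (intro suminf_pos summable_power_half) simp
  \<comment> \<open>The first entry gives the geometric majorant, the second makes the tail constant
    \<open>r * S\<close> at most \<open>1 / 2\<close>.\<close>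
  define r where "r = min (1 / 2) (1 / (2 * S))"
  have r: "0 < r" "r \<le> 1 / 2" using \<open>S > 0\<close> by (simp_all add: r_def)
  have "r * S \<le> 1 / (2 * S) * S"
    using \<open>S > 0\<close> by (intro mult_right_mono) (auto simp: r_def)
  then have rS: "r * S \<le> 1 / 2" using \<open>S > 0\<close> by simp
  \<comment> \<open>With this scale \<open>Im (inverse w)\<close> equals \<open>- C * Im w\<close>
    on the arc and is at least that large inside the half disc, so \<open>C\<close> factors out of
    every comparison.\<close>
  define C where "C = 1 / r\<^sup>2"
  have C: "C > 0" using r by (simp add: C_def)
  define H where "H w = complex_of_real C * (1 + 2 ^ k * w + tail k w)" for w
  \<comment> \<open>Here \<open>k \<ge> 1\<close> enters: a linear coefficient of at least 2 beats
    the contribution 1 of the pole together with the tail's \<open>1 / 2\<close>.\<close>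
  have two: "(2::real) ^ k \<ge> 2" using power_increasing[OF assms, of "2::real"] by simp
  have Im_inverse: "C * (- Im w) \<le> Im (inverse w)" if w: "cmod w \<le> r" "Im w < 0" for w
  proof -
    have "w \<noteq> 0" "cmod w > 0" using w(2) by auto
    then have "C \<le> 1 / (cmod w)\<^sup>2"
      unfolding C_def using w(1) r(1) by (intro divide_left_mono power_mono mult_pos_pos zero_less_power) auto
    then have "C * (- Im w) \<le> 1 / (cmod w)\<^sup>2 * (- Im w)"
      using w(2) by (intro mult_right_mono) auto
    also have "\<dots> = Im (inverse w)" by (simp add: cmod_power2)
    finally show ?thesis .
  qed
  have Im_H: "Im (H w) = C * (2 ^ k * Im w + Im (tail k w))" for w
  proof -
    have "2 ^ k * w = complex_of_real (2 ^ k) * w" by simp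
    then show ?thesis unfolding H_def by (simp only: Im_of_real_mult plus_complex.sel one_complex.sel add_0)
  qed
  have H_sums: "(\<lambda>n. complex_of_real (C * real (Suc n) ^ k) * w ^ n) sums H w" if "cmod w < 1" for w
    using sums_mult[OF head_tail_sums[OF that, of k], of "complex_of_real C"]
    by (simp add: H_def mult_ac)
  interpret half_disc_univalent H r 1
  proof
    show "0 < r" "r < 1" using r by auto
    show "H holomorphic_on ball 0 1"
      by (rule power_series_holomorphic[where a = "\<lambda>n. complex_of_real (C * real (Suc n) ^ k)"])
         (use H_sums in simp)
    show "H (cnj w) = cnj (H w)" if "cmod w < 1" for w
      using tail_cnj[OF that] by (simp add: H_def)
    show "inj_on (\<lambda>w. inverse w + H w) {w. cmod w < r \<and> Im w < 0}"
    proof (rule inj_onI, rule ccontr)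
      fix x y assume xy: "x \<in> {w. cmod w < r \<and> Im w < 0}" "y \<in> {w. cmod w < r \<and> Im w < 0}"
        and eq: "inverse x + H x = inverse y + H y" and ne: "x \<noteq> y"
      define Q where "Q = (tail k x - tail k y) / (x - y)"
      have nz: "x \<noteq> 0" "y \<noteq> 0" "x - y \<noteq> 0" using xy ne by auto
      \<comment> \<open>Two expressions for the same difference: cancelling \<open>x - y\<close> and
        multiplying by \<open>y\<close> isolates \<open>inverse x\<close>, whose imaginary part is
        bounded below by \<open>Im_inverse\<close>.\<close>
      have "H x - H y = complex_of_real C * (x - y) * (2 ^ k + Q)"
        using nz by (simp add: H_def Q_def divide_simps) (simp add: algebra_simps)
      moreover have "H x - H y = (x - y) * (inverse x * inverse y)"
        using eq nz by (simp add: field_simps)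
      ultimately have "inverse x * inverse y = complex_of_real C * (2 ^ k + Q)"
        using nz(3) by (metis mult.assoc mult.commute mult_cancel_left)
      then have "inverse x = complex_of_real C * (complex_of_real (2 ^ k) * y + y * Q)"
        using nz by (simp add: field_simps)
      then have "Im (inverse x) = C * (2 ^ k * Im y + Im (y * Q))"
        by (simp only: Im_of_real_mult plus_complex.sel)
      then have "C * (- Im x) \<le> C * (2 ^ k * Im y + Im (y * Q))"
        using Im_inverse[of x] xy by (metis less_imp_le mem_Collect_eq)
      then have "- Im x \<le> 2 ^ k * Im y + Im (y * Q)" using C by (rule mult_left_le_imp_le)
      moreover have "Im (y * Q) \<le> 1 / 2 * (\<bar>Im x\<bar> + \<bar>Im y\<bar>)"
      proof -
        have "\<bar>Im (y * Q)\<bar> \<le> r * S * (\<bar>Im x\<bar> + \<bar>Im y\<bar>)"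
          unfolding Q_def S_def using xy r ne by (intro tail_divided_difference) auto
        also have "\<dots> \<le> 1 / 2 * (\<bar>Im x\<bar> + \<bar>Im y\<bar>)"
          by (intro mult_right_mono rS) simp
        finally show ?thesis by linarith
      qed
      moreover have "2 ^ k * Im y \<le> 2 * Im y" using two xy(2) by (intro mult_right_mono_neg) auto
      moreover have "Im x < 0" "Im y < 0" using xy by auto
      \<comment> \<open>The hypotheses combine to \<open>- p / 2 \<le> 3 * q / 2\<close>, with a
        positive left and a negative right side.\<close>
      moreover have False if "- p \<le> a + b" "b \<le> 1 / 2 * (\<bar>p\<bar> + \<bar>q\<bar>)" "a \<le> 2 * q" "p < 0" "q < 0"
        for a b p q :: real
        using that by (simp add: abs_of_neg)
      ultimately show False by blast
    qed
    show "Im (inverse w + H w) < 0" if w: "cmod w = r" "Im w < 0" for w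
    proof -
      have "Im (inverse w) = C * (- Im w)"
        unfolding C_def w(1)[symmetric] by (simp add: cmod_power2)
      then have "Im (inverse w + H w) = C * (- Im w + 2 ^ k * Im w + Im (tail k w))"
        unfolding plus_complex.sel Im_H by (simp add: algebra_simps)
      moreover have "Im (tail k w) \<le> 1 / 2 * \<bar>Im w\<bar>"
      proof -
        have "\<bar>Im (tail k w)\<bar> \<le> r * S * \<bar>Im w\<bar>"
          unfolding S_def using w r by (intro tail_Im_bound) auto
        also have "\<dots> \<le> 1 / 2 * \<bar>Im w\<bar>" by (intro mult_right_mono rS) simp
        finally show ?thesis by linarith
      qed
      moreover have "2 ^ k * Im w \<le> 2 * Im w" using two w(2) by (intro mult_right_mono_neg) auto
      \<comment> \<open>The sum is at most \<open>- p + 2 * p - p / 2 = p / 2\<close>.\<close>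
      moreover have "- p + a + b < 0" if "b \<le> 1 / 2 * \<bar>p\<bar>" "a \<le> 2 * p" "p < 0" for a b p :: real
        using that by (simp add: abs_of_neg)
      ultimately show ?thesis using w(2) C by (simp only: mult_pos_neg)
    qed
  qed
  obtain \<mu> where \<mu>: "compactly_supported_distribution \<mu>" "is_free_R_transform \<mu> (\<lambda>w. w * H w)"
    using exists_free_distribution by blast
  have "\<forall>\<^sub>F w in nhds 0. w \<in> ball (0::complex) 1"
    by (intro eventually_nhds_in_open) auto
  then have "\<forall>\<^sub>F w in nhds 0. (\<lambda>n. complex_of_real (C * real (Suc n) ^ k) * w ^ Suc n) sums (w * H w)"
  proof eventually_elim
    case (elim w)
    then show ?case using sums_mult[OF H_sums[of w], of w] by (simp add: mult_ac)
  qed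
  with \<mu> C show ?thesis unfolding has_free_cumulants_def by blast
qed

end
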